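(* The assumption that $W\in C[0,1]$ is a Martin-Löf random Brownian motion does not imply that for all but finitely many $n\in\mathbb{N}$ there is a string $x=(x_1,\ldots,x_n)\in\{\pm1\}^n$ with $$d(\ell_x,W)\le\frac12\sqrt{\frac{\log n}{n}}.$$ That is, there exists a Martin-Löf random $W\in C[0,1]$ such that for infinitely many $n\in\mathbb{N}$ no $x\in\{\pm1\}^n$ satisfies $d(\ell_x,W)\le\frac12\sqrt{\frac{\log n}{n}}$.
   Context: $\log$ is the natural logarithm. $C[0,1]$ is the space of continuous functions $f:[0,1]\to\mathbb{R}$ with the uniform metric $d(f,g)=\max_{t\in[0,1]}|f(t)-g(t)|$, equipped with Wiener measure $\mathbb{P}$ (the law of standard Brownian motion on $[0,1]$ started at $0$). Martin-Löf randomness in $C[0,1]$: let $\mathfrak{S}$ be the countable set of all open balls in $C[0,1]$ with rational radii whose centers are piecewise linear functions with rational break points and rational values at the break points. Each member of $\mathfrak{S}$ is specified by a finite list of rational numbers; write $\mathfrak{S}=\{T_n:n\in\mathbb{N}\}$, where the list of rationals representing $T_n$ is uniformly computable in $n$. A set $M\subseteq C[0,1]$ is a Martin-Löf null set if there is a total computable function $\psi:\mathbb{N}\times\mathbb{N}\to\mathbb{N}$ such that, with $U_n=\bigcup_m T_{\psi(n,m)}$, we have $\mathbb{P}(U_n)\le 2^{-n}$ for all $n$ and $M\subseteq\bigcap_n U_n$. A function $W\in C[0,1]$ is Martin-Löf random (a Martin-Löf random Brownian motion) if it belongs to no Martin-Löf null set. For $x=(x_1,\dots,x_n)\in\{\pm1\}^n$,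 $\ell_x\in C[0,1]$ is the function with $\ell_x(0)=0$ that is linear on each interval $[\frac{i-1}{n},\frac{i}{n}]$, $1\le i\le n$, with slope $x_i\sqrt{n}$. *)

theory Defs
  imports "HOL-Probability.Probability" "HOL-Library.Nat_Bijection" "HOL-Library.Countable"
begin

section \<open>The space \<open>C[0,1]\<close> and Wiener measure\<close>

text \<open>Points of \<^term>\<open>cfunspace\<close> are extensional: they take the value \<^term>\<open>undefined\<close>
  outside \<open>[0,1]\<close>.\<close>

definition C01 :: "(real \<Rightarrow> real) metric" where
  "C01 = cfunspace (top_of_set {0..1}) euclidean_metric"

definition borel_C01 :: "(real \<Rightarrow> real) measure" where
  "borel_C01 = sigma (mspace C01) {U. openin (mtopology_of C01) U}"

text \<open>Standard Brownian motion on the time interval \<open>[0,1]\<close>, started at \<open>0\<close>. The second argument of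
  \<^term>\<open>normal_density\<close> is the standard deviation.\<close>

definition standard_brownian_motion :: "'a measure \<Rightarrow> (real \<Rightarrow> 'a \<Rightarrow> real) \<Rightarrow> bool" where
  "standard_brownian_motion M B \<longleftrightarrow>
     prob_space M \<and>
     (\<forall>t\<in>{0..1}. B t \<in> borel_measurable M) \<and>
     (\<forall>\<omega>\<in>space M. continuous_on {0..1} (\<lambda>t. B t \<omega>)) \<and>
     (AE \<omega> in M. B 0 \<omega> = 0) \<and>
     (\<forall>s t. 0 \<le> s \<longrightarrow> s < t \<longrightarrow> t \<le> 1 \<longrightarrow>
        distributed M lborel (\<lambda>\<omega>. B t \<omega> - B s \<omega>) (normal_density 0 (sqrt (t - s)))) \<and>
     (\<forall>(k::nat) \<tau>. (\<forall>i\<le>k. \<tau> i \<in> {0..1}) \<longrightarrow> (\<forall>i<k. \<tau> i < \<tau> (Suc i)) \<longrightarrow>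
        prob_space.indep_vars M (\<lambda>_. borel) (\<lambda>i \<omega>. B (\<tau> (Suc i)) \<omega> - B (\<tau> i) \<omega>) {..<k})"

text \<open>A measure on \<open>C[0,1]\<close> is the law of standard Brownian motion iff the coordinate process is
  a standard Brownian motion under it.\<close>

definition wiener_measure :: "(real \<Rightarrow> real) measure \<Rightarrow> bool" where
  "wiener_measure P \<longleftrightarrow>
     sets P = sets borel_C01 \<and> standard_brownian_motion P (\<lambda>t W. W t)"


section \<open>Computable functions\<close>

text \<open>Programs for partial recursive functions on lists of natural numbers;
  \<open>recfn_eval p xs y\<close> says that program \<open>p\<close> halts on input \<open>xs\<close> with output \<open>y\<close>.\<close>

datatype recfn =
    Zero
  | Succ
  | Proj nat
  | Comp recfn "recfn list"
  | PrimRec recfn recfn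
  | Mu recfn

instance recfn :: countable
  by countable_datatype

inductive recfn_eval :: "recfn \<Rightarrow> nat list \<Rightarrow> nat \<Rightarrow> bool" where
  Zero: "recfn_eval Zero xs 0"
| Succ: "recfn_eval Succ [x] (Suc x)"
| Proj: "i < length xs \<Longrightarrow> recfn_eval (Proj i) xs (xs ! i)"
| Comp: "list_all2 (\<lambda>g y. recfn_eval g xs y) gs ys \<Longrightarrow> recfn_eval f ys z
    \<Longrightarrow> recfn_eval (Comp f gs) xs z"
| PrimRec_0: "recfn_eval f xs y \<Longrightarrow> recfn_eval (PrimRec f g) (0 # xs) y"
| PrimRec_Suc: "recfn_eval (PrimRec f g) (n # xs) y \<Longrightarrow> recfn_eval g (n # y # xs) z
    \<Longrightarrow> recfn_eval (PrimRec f g) (Suc n # xs) z"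
| Mu: "recfn_eval f (n # xs) 0 \<Longrightarrow> (\<forall>m<n. \<exists>y. recfn_eval f (m # xs) (Suc y))
    \<Longrightarrow> recfn_eval (Mu f) xs n"

definition computable1 :: "(nat \<Rightarrow> nat) \<Rightarrow> bool" where
  "computable1 \<phi> \<longleftrightarrow> (\<exists>p. \<forall>n y. recfn_eval p [n] y \<longleftrightarrow> y = \<phi> n)"

definition computable2 :: "(nat \<Rightarrow> nat \<Rightarrow> nat) \<Rightarrow> bool" where
  "computable2 \<phi> \<longleftrightarrow> (\<exists>p. \<forall>n m y. recfn_eval p [n, m] y \<longleftrightarrow> y = \<phi> n m)"

definition rat_encode :: "rat \<Rightarrow> nat" where
  "rat_encode q = (case quotient_of q of (a, b) \<Rightarrow> prod_encode (int_encode a, nat b))"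

definition computable_rat_lists :: "(nat \<Rightarrow> rat list) \<Rightarrow> bool" where
  "computable_rat_lists R \<longleftrightarrow> computable1 (\<lambda>n. list_encode (map rat_encode (R n)))"


section \<open>Rational balls and Martin-Loef randomness\<close>

text \<open>\<open>f\<close> is the piecewise linear function on \<open>[0,1]\<close> with the given break points and values; the
  end points \<open>0\<close> and \<open>1\<close> are listed among the break points.\<close>

definition rational_pl :: "(rat \<times> rat) list \<Rightarrow> (real \<Rightarrow> real) \<Rightarrow> bool" where
  "rational_pl ps f \<longleftrightarrow>
     f \<in> mspace C01 \<and>
     2 \<le> length ps \<and> fst (hd ps) = 0 \<and> fst (last ps) = 1 \<and> sorted_wrt (<) (map fst ps) \<and>
     (\<forall>i. Suc i < length ps \<longrightarrow>
        (let s = real_of_rat (fst (ps ! i)); u = real_of_rat (snd (ps ! i));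
             t = real_of_rat (fst (ps ! Suc i)); v = real_of_rat (snd (ps ! Suc i))
         in \<forall>x\<in>{s..t}. f x = u + (v - u) * ((x - s) / (t - s))))"

definition represents_ball :: "rat list \<Rightarrow> (real \<Rightarrow> real) set \<Rightarrow> bool" where
  "represents_ball qs U \<longleftrightarrow>
     (\<exists>r ps f. qs = r # concat (map (\<lambda>(t, v). [t, v]) ps) \<and> 0 < r \<and> rational_pl ps f \<and>
        U = mball_of C01 f (real_of_rat r))"

definition rational_balls :: "(real \<Rightarrow> real) set set" where
  "rational_balls = {U. \<exists>qs. represents_ball qs U}"

definition computable_ball_enumeration :: "(nat \<Rightarrow> (real \<Rightarrow> real) set) \<Rightarrow> bool" where
  "computable_ball_enumeration T \<longleftrightarrow>
     range T = rational_balls \<and>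
     (\<exists>R. computable_rat_lists R \<and> (\<forall>n. represents_ball (R n) (T n)))"

definition martin_loef_null ::
    "(real \<Rightarrow> real) measure \<Rightarrow> (nat \<Rightarrow> (real \<Rightarrow> real) set) \<Rightarrow> (real \<Rightarrow> real) set \<Rightarrow> bool" where
  "martin_loef_null P T M \<longleftrightarrow>
     M \<subseteq> mspace C01 \<and>
     (\<exists>\<psi>. computable2 \<psi> \<and>
        (\<forall>n. measure P (\<Union>m. T (\<psi> n m)) \<le> 1 / 2 ^ n) \<and>
        M \<subseteq> (\<Inter>n. \<Union>m. T (\<psi> n m)))"

definition martin_loef_random ::
    "(real \<Rightarrow> real) measure \<Rightarrow> (nat \<Rightarrow> (real \<Rightarrow> real) set) \<Rightarrow> (real \<Rightarrow> real) \<Rightarrow> bool" where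
  "martin_loef_random P T W \<longleftrightarrow> W \<in> mspace C01 \<and> (\<forall>M. martin_loef_null P T M \<longrightarrow> W \<notin> M)"


section \<open>Random walk paths\<close>

text \<open>The entry of \<open>x\<close> at index \<open>i\<close> (counted from \<open>0\<close>) contributes its slope times the length of
  \<open>[0,t] \<inter> [i/n, (i+1)/n]\<close>; lemmas \<open>ell_0\<close> and \<open>ell_linear\<close> below are the characterization by
  slopes.\<close>

definition ell :: "real list \<Rightarrow> real \<Rightarrow> real" where
  "ell x = (let n = length x in
     (\<lambda>t\<in>{0..1}. \<Sum>i<n. x ! i * sqrt n * max 0 (min t ((i + 1) / n) - i / n)))"

lemma ell_0: "ell x 0 = 0"
proof -
  have "max 0 (min 0 ((real i + 1) / real n) - real i / real n) = 0" for i n :: nat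
    by simp
  then show ?thesis
    by (simp add: ell_def Let_def)
qed

lemma ell_linear:
  assumes i: "i < length x" and t: "t \<in> {i / length x .. (i + 1) / length x}"
  shows "ell x t = ell x (i / length x) + x ! i * sqrt (length x) * (t - i / length x)"
proof -
  define n where "n = length x"
  have n: "real n > 0" using i by (cases x) (simp_all add: n_def)
  define g where "g = (\<lambda>j s. x ! j * sqrt n * max 0 (min s ((real j + 1) / n) - real j / n))"
  have t': "real i / n \<le> t" "t \<le> (real i + 1) / n"
    using t by (auto simp: n_def add.commute)
  have "(real i + 1) / n \<le> 1" using i n by (simp add: n_def)
  then have t01: "t \<in> {0..1}" "real i / n \<in> {0..1}"
    using t' zero_le_divide_iff[of "real i" "real n"] unfolding atLeastAtMost_iff by linarith+
  have eq: "ell x s = (\<Sum>j<n. g j s)" if "s \<in> {0..1}" for s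
    using that by (simp add: ell_def Let_def n_def g_def add.commute)
  have other: "g j t = g j (real i / n)" if "j \<noteq> i" for j
  proof (cases "j < i")
    case True
    then have "(real j + 1) / n \<le> real i / n"
      using n by (intro divide_right_mono) auto
    then have "min t ((real j + 1) / n) = (real j + 1) / n"
        "min (real i / n) ((real j + 1) / n) = (real j + 1) / n"
      using t' by linarith+
    then show ?thesis by (simp only: g_def)
  next
    case False
    then have "(real i + 1) / n \<le> real j / n"
      using n that by (intro divide_right_mono) auto
    then have "max 0 (min t ((real j + 1) / n) - real j / n) = 0"
        "max 0 (min (real i / n) ((real j + 1) / n) - real j / n) = 0"
      using t' by linarith+
    then show ?thesis by (simp only: g_def)
  qed
  have this_i: "g i t = g i (real i / n) + x ! i * sqrt n * (t - real i / n)"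
  proof -
    have "max 0 (min t ((real i + 1) / n) - real i / n) = t - real i / n"
        "max 0 (min (real i / n) ((real i + 1) / n) - real i / n) = 0"
      using t' by linarith+
    then show ?thesis unfolding g_def by simp
  qed
  have "(\<Sum>j<n. g j t) = g i t + (\<Sum>j\<in>{..<n} - {i}. g j t)"
    using i by (simp add: n_def sum.remove)
  also have "(\<Sum>j\<in>{..<n} - {i}. g j t) = (\<Sum>j\<in>{..<n} - {i}. g j (real i / n))"
    using other by (intro sum.cong) auto
  also have "g i t + \<dots> = (\<Sum>j<n. g j (real i / n)) + x ! i * sqrt n * (t - real i / n)"
    using i by (simp add: n_def sum.remove this_i[unfolded n_def])
  finally show ?thesis
    using eq t01 by (simp add: n_def)
qed

lemma ell_in_C01: "ell x \<in> mspace C01"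
proof -
  define h where "h = (\<lambda>t::real. \<Sum>i<length x. x ! i * sqrt (length x) *
    max 0 (min t ((i + 1) / length x) - i / length x))"
  have c: "continuous_on {0..1} h"
    unfolding h_def by (intro continuous_intros)
  have e: "ell x = restrict h {0..1}"
    by (auto simp: ell_def h_def Let_def)
  have c': "continuous_on {0..1} (ell x)"
    unfolding e using c by (simp cong: continuous_on_cong_simp)
  then have "bounded (ell x ` {0..1})"
    by (intro compact_imp_bounded compact_continuous_image) auto
  then show ?thesis
    using c' unfolding C01_def by (auto simp: e)
qed

end

theory Submission
  imports Defs "HOL-Real_Asymp.Real_Asymp"
begin

text \<open>Increments of \<open>\<ell>\<^sub>x\<close> over \<open>[i/n, (i+1)/n]\<close> have size \<open>1/\<surd>n\<close>, so if some \<open>\<ell>\<^sub>x\<close> is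
  within \<open>\<surd>(log n / n) / 2\<close> of \<open>W\<close>, then all \<open>n\<close> increments of \<open>W\<close> are at most
  \<open>(\<surd>(log n) + 1) / \<surd>n\<close> in absolute value. The largest of these \<open>n\<close> independent Gaussian
  increments is typically about \<open>\<surd>(2 log n) / \<surd>n\<close>, so the probability of this event tends to \<open>0\<close>,
  and almost surely it fails for infinitely many \<open>n\<close>. As there are only countably many programs,
  almost every \<open>W\<close> is moreover Martin-Loef random.\<close>

section \<open>Almost every path is Martin-Loef random\<close>

text \<open>A program determines the function it computes, so choosing one program for each function
  is an injection into the countable type \<open>recfn\<close>.\<close>

lemma countable_computable2: "countable {\<psi>. computable2 \<psi>}"
proof -
  define prog where "prog \<psi> = (SOME p. \<forall>n m y. recfn_eval p [n, m] y \<longleftrightarrow> y = \<psi> n m)" for \<psi>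
  have prog: "recfn_eval (prog \<psi>) [n, m] y \<longleftrightarrow> y = \<psi> n m" if "computable2 \<psi>" for \<psi> n m y
    using someI_ex[OF that[unfolded computable2_def]] unfolding prog_def by blast
  have "inj_on prog {\<psi>. computable2 \<psi>}"
  proof (intro inj_onI ext)
    fix \<phi> \<psi> n m
    assume "\<phi> \<in> {\<psi>. computable2 \<psi>}" "\<psi> \<in> {\<psi>. computable2 \<psi>}" "prog \<phi> = prog \<psi>"
    then show "\<phi> n m = \<psi> n m"
      using prog[of \<phi> n m "\<phi> n m"] prog[of \<psi> n m "\<phi> n m"] by simp
  qed
  then show ?thesis
    using countableI_type countable_image_inj_on by blast
qed

lemma space_wiener:
  assumes "wiener_measure P"
  shows "space P = mspace C01"
proof -
  have "{U. openin (mtopology_of C01) U} \<subseteq> Pow (mspace C01)"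
    using openin_subset by fastforce
  then have "space borel_C01 = mspace C01"
    unfolding borel_C01_def by (rule space_measure_of)
  moreover have "space P = space borel_C01"
    using assms unfolding wiener_measure_def by (intro sets_eq_imp_space_eq) simp
  ultimately show ?thesis
    by simp
qed

lemma sets_enumerated_ball:
  assumes "wiener_measure P" "computable_ball_enumeration T"
  shows "T n \<in> sets P"
proof -
  have "T n \<in> rational_balls"
    using assms(2) unfolding computable_ball_enumeration_def by blast
  then obtain f r where "T n = mball_of C01 f r"
    unfolding rational_balls_def represents_ball_def by blast
  then have "openin (mtopology_of C01) (T n)"
    by (simp add: mtopology_of_def mball_of_def Metric_space.openin_mball[OF Metric_space_mspace_mdist])
  moreover have "{U. openin (mtopology_of C01) U} \<subseteq> Pow (mspace C01)"
    using openin_subset by fastforce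
  ultimately have "T n \<in> sets borel_C01"
    unfolding borel_C01_def by (auto simp: sets_measure_of)
  then show ?thesis
    using assms(1) unfolding wiener_measure_def by simp
qed

text \<open>Null sets can be arbitrary subsets, but each lies in the intersection of a test.
  Avoiding all these intersections is enough, and they are countably many measurable sets of
  probability 0.\<close>

lemma AE_martin_loef_random:
  assumes P: "wiener_measure P" and T: "computable_ball_enumeration T"
  shows "AE W in P. martin_loef_random P T W"
proof -
  interpret prob_space P
    using P unfolding wiener_measure_def standard_brownian_motion_def by blast
  define \<Psi> where "\<Psi> = {\<psi>. computable2 \<psi> \<and> (\<forall>n. measure P (\<Union>m. T (\<psi> n m)) \<le> 1 / 2 ^ n)}"
  have "countable \<Psi>"
    using countable_computable2 by (rule countable_subset[rotated]) (auto simp: \<Psi>_def)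
  moreover have "AE W in P. W \<notin> (\<Inter>n. \<Union>m. T (\<psi> n m))" if \<psi>: "\<psi> \<in> \<Psi>" for \<psi>
  proof -
    note [measurable] = sets_enumerated_ball[OF P T]
    let ?N = "\<Inter>n. \<Union>m. T (\<psi> n m)"
    have N: "?N \<in> sets P"
      by measurable
    have "prob ?N \<le> (1 / 2) ^ n" for n
    proof -
      have "prob ?N \<le> prob (\<Union>m. T (\<psi> n m))"
        by (intro finite_measure_mono) auto
      also have "\<dots> \<le> 1 / 2 ^ n"
        using \<psi> by (simp add: \<Psi>_def)
      finally show ?thesis
        by (simp add: power_one_over)
    qed
    moreover have "(\<lambda>n. (1 / 2 :: real) ^ n) \<longlonglongrightarrow> 0"
      by (intro LIMSEQ_power_zero) auto
    ultimately have "prob ?N \<le> 0"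
      by (intro LIMSEQ_le_const) auto
    then have "prob ?N = 0"
      by (simp add: measure_le_0_iff)
    then show ?thesis
      using prob_eq_0[OF N] by simp
  qed
  ultimately have "AE W in P. \<forall>\<psi>\<in>\<Psi>. W \<notin> (\<Inter>n. \<Union>m. T (\<psi> n m))"
    by (subst AE_ball_countable) auto
  then show ?thesis
  proof (rule AE_mp, intro AE_I2 impI)
    fix W
    assume "W \<in> space P" and avoid: "\<forall>\<psi>\<in>\<Psi>. W \<notin> (\<Inter>n. \<Union>m. T (\<psi> n m))"
    have "W \<notin> M" if null: "martin_loef_null P T M" for M
    proof -
      obtain \<psi> where "\<psi> \<in> \<Psi>" and M: "M \<subseteq> (\<Inter>n. \<Union>m. T (\<psi> n m))"
        using null unfolding martin_loef_null_def \<Psi>_def by auto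
      then show ?thesis
        using bspec[OF avoid] subsetD[OF M] by metis
    qed
    then show "martin_loef_random P T W"
      using \<open>W \<in> space P\<close> unfolding martin_loef_random_def by (simp add: space_wiener[OF P])
  qed
qed

section \<open>From uniform approximation to increments\<close>

lemma dist_le_mdist_C01:
  assumes "f \<in> mspace C01" "g \<in> mspace C01" "t \<in> {0..1}"
  shows "\<bar>f t - g t\<bar> \<le> mdist C01 f g"
  using mdist_cfunspace_imp_mdist_le[OF assms(1,2)[unfolded C01_def] order_refl] assms(3)
  by (simp add: C01_def dist_real_def)

text \<open>Triangle inequality through the values of \<open>ell x\<close> at the two grid points:
  each end costs at most \<epsilon>, and the step of \<open>ell x\<close> between them has size
  exactly \<open>1 / sqrt n\<close>.\<close>

lemma increment_le_of_ell_close: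
  assumes W: "W \<in> mspace C01" and x: "length x = n" "set x \<subseteq> {-1, 1}" and i: "i < n"
    and close: "mdist C01 (ell x) W \<le> \<epsilon>"
  shows "\<bar>W (real (Suc i) / n) - W (real i / n)\<bar> \<le> 2 * \<epsilon> + 1 / sqrt n"
proof -
  have n: "real n > 0"
    using i by simp
  have t: "real (Suc i) / n \<in> {0..1}" "real i / n \<in> {0..1}"
    using i n by (auto simp: divide_simps)
  have "x ! i \<in> {-1, 1}"
    using x i nth_mem by blast
  moreover have "ell x (real (Suc i) / n) = ell x (real i / n) + x ! i * sqrt n * (1 / n)"
  proof -
    have "real (Suc i) / n \<in> {real i / length x .. (real i + 1) / length x}"
      using n x by (auto simp: divide_simps)
    from ell_linear[OF _ this] show ?thesis
      using i x by (simp add: diff_divide_distrib[symmetric])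
  qed
  moreover have "sqrt n * (1 / n) = 1 / sqrt n"
    using n by (simp add: field_simps)
  ultimately have "\<bar>ell x (real (Suc i) / n) - ell x (real i / n)\<bar> = 1 / sqrt n"
    by (auto simp: abs_mult)
  then show ?thesis
    using dist_le_mdist_C01[OF ell_in_C01 W t(1), of x] dist_le_mdist_C01[OF ell_in_C01 W t(2), of x]
      close by linarith
qed

section \<open>Gaussian tails and the probability of small increments\<close>

text \<open>The tail contains the event that \<open>X\<close> falls in an interval of length
  \<sigma> starting at \<open>a * \<sigma>\<close>, where the density is at least its value at the
  right end. Moving from \<open>a\<close> to \<open>a + 1\<close> costs only a factor
  \<open>exp (- a - 1/2)\<close>, which is harmless for \<open>a\<close> of order
  \<open>sqrt (ln n)\<close>.\<close>

lemma (in prob_space) prob_normal_tail_ge: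
  assumes X: "distributed M lborel X (normal_density 0 \<sigma>)" and \<sigma>: "\<sigma> > 0" and a: "a \<ge> 0"
  shows "std_normal_density (a + 1) \<le> prob {\<omega> \<in> space M. \<bar>X \<omega>\<bar> > a * \<sigma>}"
proof -
  have [measurable]: "X \<in> borel_measurable M"
    using distributed_measurable[OF X] by simp
  let ?I = "{a * \<sigma> <.. (a + 1) * \<sigma>}"
  have "ennreal (std_normal_density (a + 1)) =
      (\<integral>\<^sup>+x. ennreal (normal_density 0 \<sigma> ((a + 1) * \<sigma>)) * indicator ?I x \<partial>lborel)"
  proof -
    have "emeasure lborel ?I = ennreal \<sigma>"
      using \<sigma> by (simp add: algebra_simps)
    \<comment> \<open>The length \<sigma> of the interval cancels the factor
      \<open>1 / \<sigma>\<close> in the density.\<close>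
    moreover have "normal_density 0 \<sigma> ((a + 1) * \<sigma>) * \<sigma> = std_normal_density (a + 1)"
      using \<sigma> by (simp add: normal_density_def real_sqrt_mult power_mult_distrib)
    ultimately show ?thesis
      using \<sigma> by (subst nn_integral_cmult_indicator) (simp_all flip: ennreal_mult'')
  qed
  also have "\<dots> \<le> (\<integral>\<^sup>+x. ennreal (normal_density 0 \<sigma> x) * indicator ?I x \<partial>lborel)"
  proof (intro nn_integral_mono)
    fix x
    have "normal_density 0 \<sigma> ((a + 1) * \<sigma>) \<le> normal_density 0 \<sigma> x" if "x \<in> ?I"
    proof -
      have "x\<^sup>2 \<le> ((a + 1) * \<sigma>)\<^sup>2"
        using that a \<sigma> by (intro power_mono) (auto intro: order_trans[of 0 "a * \<sigma>"])
      then show ?thesis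
        using \<sigma> by (auto simp: normal_density_def intro!: divide_right_mono mult_left_mono)
    qed
    then show "ennreal (normal_density 0 \<sigma> ((a + 1) * \<sigma>)) * indicator ?I x
        \<le> ennreal (normal_density 0 \<sigma> x) * indicator ?I x"
      by (auto simp: indicator_def intro!: ennreal_leI)
  qed
  also have "\<dots> = emeasure M (X -` ?I \<inter> space M)"
    by (subst distributed_emeasure[OF X]) auto
  also have "\<dots> \<le> emeasure M {\<omega> \<in> space M. \<bar>X \<omega>\<bar> > a * \<sigma>}"
    by (intro emeasure_mono) auto
  finally show ?thesis
    by (simp add: emeasure_eq_measure)
qed

text \<open>The bound is \<open>2 * \<epsilon> + 1 / sqrt n\<close> for
  \<open>\<epsilon> = sqrt (ln n / n) / 2\<close>, written as a multiple of the standard deviation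
  \<open>1 / sqrt n\<close> of a Brownian increment over a grid interval.\<close>

definition small_increments :: "nat \<Rightarrow> (real \<Rightarrow> real) set" where
  "small_increments n = {W \<in> mspace C01. \<forall>i<n.
     \<bar>W (real (Suc i) / n) - W (real i / n)\<bar> \<le> (sqrt (ln n) + 1) * (1 / sqrt n)}"

text \<open>By independence the probability is a product of \<open>n\<close> factors, each at most
  \<open>1 - p \<le> exp (- p)\<close>, where \<open>p\<close> is the Gaussian tail bound for the
  threshold \<open>a = sqrt (ln n) + 1\<close>, hence the density at \<open>a + 1\<close>.\<close>

lemma
  assumes P: "wiener_measure P" and n: "n \<ge> 1"
  shows prob_small_increments_le:
      "measure P (small_increments n) \<le> exp (- (n * std_normal_density (sqrt (ln n) + 2)))"
    and sets_small_increments: "small_increments n \<in> sets P"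
proof -
  have BM: "standard_brownian_motion P (\<lambda>t W. W t)"
    using P unfolding wiener_measure_def by blast
  interpret prob_space P
    using BM unfolding standard_brownian_motion_def by blast
  define a where "a = sqrt (ln n) + 1"
  define D where "D i W = W (real (Suc i) / n) - W (real i / n)" for i and W :: "real \<Rightarrow> real"
  define A where "A = {y::real. \<bar>y\<bar> \<le> a * (1 / sqrt n)}"
  have a: "a \<ge> 0"
    using n by (simp add: a_def)
  have A [measurable]: "A \<in> sets borel"
    unfolding A_def by measurable
  have coord: "real i / n \<in> {0..1}" if "i \<le> n" for i
    using that n by (auto simp: divide_simps)
  have D_meas: "D i \<in> borel_measurable P" if "i < n" for i
    using BM coord[of i] coord[of "Suc i"] that
    unfolding standard_brownian_motion_def D_def[abs_def] by (intro borel_measurable_diff) auto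
  have indep: "indep_vars (\<lambda>_. borel) D {..<n}"
  proof -
    have grid: "\<forall>i\<le>n. real i / n \<in> {0..1}" "\<forall>i<n. real i / n < real (Suc i) / n"
      using coord by (auto simp: divide_strict_right_mono)
    have "\<forall>(k::nat) \<tau>. (\<forall>i\<le>k. \<tau> i \<in> {0..1}) \<longrightarrow> (\<forall>i<k. \<tau> i < \<tau> (Suc i)) \<longrightarrow>
        indep_vars (\<lambda>_. borel) (\<lambda>i W. W (\<tau> (Suc i)) - W (\<tau> i)) {..<k}"
      using BM unfolding standard_brownian_motion_def by (elim conjE)
    from this[THEN spec, THEN spec, THEN mp, THEN mp, OF grid] show ?thesis
      unfolding D_def[abs_def] .
  qed
  have normal: "distributed P lborel (D i) (normal_density 0 (1 / sqrt n))" if "i < n" for i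
  proof -
    have "real (Suc i) / n - real i / n = 1 / n"
      by (simp add: diff_divide_distrib[symmetric])
    moreover have "distributed P lborel (D i) (normal_density 0 (sqrt (real (Suc i) / n - real i / n)))"
    proof -
      have "0 \<le> real i / n" "real i / n < real (Suc i) / n" "real (Suc i) / n \<le> 1"
        using coord[of "Suc i"] that n by (auto simp: divide_strict_right_mono)
      moreover have "\<forall>s t. 0 \<le> s \<longrightarrow> s < t \<longrightarrow> t \<le> 1 \<longrightarrow>
          distributed P lborel (\<lambda>W. W t - W s) (normal_density 0 (sqrt (t - s)))"
        using BM unfolding standard_brownian_motion_def by (elim conjE)
      ultimately show ?thesis
        unfolding D_def[abs_def] by simp
    qed
    ultimately show ?thesis
      by (simp add: real_sqrt_divide)
  qed
  have eq: "small_increments n = (\<Inter>i\<in>{..<n}. D i -` A \<inter> space P)"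
  proof -
    have "small_increments n = {W \<in> space P. \<forall>i<n. D i W \<in> A}"
      by (simp only: small_increments_def D_def A_def a_def space_wiener[OF P] mem_Collect_eq)
    \<comment> \<open>A nonempty index set keeps the intersection inside \<open>space P\<close>; an
      empty one would give \<open>UNIV\<close>.\<close>
    moreover have "0 \<in> {..<n}"
      using n by simp
    ultimately show ?thesis
      by blast
  qed
  have meas: "D i -` A \<inter> space P \<in> sets P" if "i < n" for i
    using D_meas[OF that] A by (rule measurable_sets)
  show "small_increments n \<in> sets P"
    unfolding eq using n meas by (intro sets.finite_INT) (auto simp: lessThan_empty_iff)
  have "prob (small_increments n) = (\<Prod>i<n. prob (D i -` A \<inter> space P))"
    unfolding eq using n A by (intro indep_varsD_finite[OF indep]) (auto simp: lessThan_empty_iff)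
  also have "\<dots> \<le> (\<Prod>i<n. exp (- std_normal_density (sqrt (ln n) + 2)))"
  proof (intro prod_mono conjI)
    fix i
    assume "i \<in> {..<n}"
    then have i: "i < n"
      by simp
    have "{W \<in> space P. \<bar>D i W\<bar> > a * (1 / sqrt n)} = space P - (D i -` A \<inter> space P)"
      by (auto simp: A_def)
    then have "std_normal_density (a + 1) \<le> 1 - prob (D i -` A \<inter> space P)"
      using prob_normal_tail_ge[OF normal[OF i] _ a] prob_compl[OF meas[OF i]] n by simp
    then show "prob (D i -` A \<inter> space P) \<le> exp (- std_normal_density (sqrt (ln n) + 2))"
      using exp_ge_add_one_self[of "- std_normal_density (a + 1)"] by (simp add: a_def algebra_simps)
  qed simp
  also have "\<dots> = exp (- (n * std_normal_density (sqrt (ln n) + 2)))"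
    by (simp add: exp_of_nat_mult[symmetric])
  finally show "measure P (small_increments n) \<le> \<dots>" .
qed

text \<open>For fixed \<open>N\<close>, the paths with small increments for all
  \<open>n \<ge> N\<close> form a subset of each single event, so their probability is below bounds
  that tend to 0. A countable union over \<open>N\<close> finishes the argument.\<close>

lemma AE_infinitely_often_large_increment:
  assumes P: "wiener_measure P"
  shows "AE W in P. \<forall>N. \<exists>n\<ge>N. n \<ge> 1 \<and> W \<notin> small_increments n"
proof -
  interpret prob_space P
    using P unfolding wiener_measure_def standard_brownian_motion_def by blast
  \<comment> \<open>Expanding the square, \<open>n * std_normal_density (sqrt (ln n) + 2)\<close> is
    a constant times \<open>sqrt n * exp (- 2 * sqrt (ln n))\<close>, which tends to
    infinity.\<close>
  have lim: "(\<lambda>n. exp (- (real n * std_normal_density (sqrt (ln n) + 2)))) \<longlonglongrightarrow> 0"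
    unfolding normal_density_def by real_asymp
  have "AE W in P. \<exists>n\<ge>N. n \<ge> 1 \<and> W \<notin> small_increments n" for N
  proof -
    \<comment> \<open>The \<open>max\<close> leaves out \<open>n = 0\<close>, for which
      \<open>small_increments\<close> is the whole space.\<close>
    let ?S = "\<Inter>n\<in>{max 1 N..}. small_increments n"
    have S: "?S \<in> sets P"
      using sets_small_increments[OF P] by (intro sets.countable_INT') auto
    have "prob ?S \<le> exp (- (real n * std_normal_density (sqrt (ln n) + 2)))" if "n \<ge> max 1 N" for n
    proof -
      have "prob ?S \<le> prob (small_increments n)"
        using that sets_small_increments[OF P] by (intro finite_measure_mono) auto
      then show ?thesis
        using prob_small_increments_le[OF P, of n] that by simp
    qed
    then have "prob ?S \<le> 0"
      by (intro LIMSEQ_le_const[OF lim]) blast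
    then have "prob ?S = 0"
      by (simp add: measure_le_0_iff)
    then have "AE W in P. W \<notin> ?S"
      using prob_eq_0[OF S] by simp
    then show ?thesis
      by eventually_elim auto
  qed
  then show ?thesis
    by (simp add: AE_all_countable)
qed

section \<open>A random path with infinitely many large increments\<close>

theorem corollary4p5:
  fixes P :: "(real \<Rightarrow> real) measure" and T :: "nat \<Rightarrow> (real \<Rightarrow> real) set"
  assumes "wiener_measure P"
    and "computable_ball_enumeration T"
  shows "\<exists>W. martin_loef_random P T W \<and>
    infinite {n. n \<ge> 1 \<and>
      \<not> (\<exists>x. length x = n \<and> set x \<subseteq> {-1, 1} \<and>
            mdist C01 (ell x) W \<le> 1 / 2 * sqrt (ln (real n) / real n))}"
proof -
  interpret prob_space P
    using assms(1) unfolding wiener_measure_def standard_brownian_motion_def by blast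
  have "AE W in P. martin_loef_random P T W \<and> (\<forall>N. \<exists>n\<ge>N. n \<ge> 1 \<and> W \<notin> small_increments n)"
    using AE_martin_loef_random[OF assms] AE_infinitely_often_large_increment[OF assms(1)]
    by eventually_elim simp
  \<comment> \<open>An almost sure property of a probability space holds at some point, since the
    filter of almost sure events is proper.\<close>
  then obtain W where random: "martin_loef_random P T W"
      and large: "\<And>N. \<exists>n\<ge>N. n \<ge> 1 \<and> W \<notin> small_increments n"
    using eventually_happens'[OF ae_filter_bot] by blast
  have W: "W \<in> mspace C01"
    using random unfolding martin_loef_random_def by blast
  \<comment> \<open>Used in contrapositive form: each \<open>n\<close> at which membership fails is
    one with no close walk path.\<close>
  have "W \<in> small_increments n"
    if x: "length x = n" "set x \<subseteq> {-1, 1}" "mdist C01 (ell x) W \<le> 1 / 2 * sqrt (ln (real n) / real n)"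
    for n x
  proof -
    have "2 * (1 / 2 * sqrt (ln (real n) / real n)) + 1 / sqrt n = (sqrt (ln n) + 1) * (1 / sqrt n)"
      by (simp add: real_sqrt_divide add_divide_distrib)
    then show ?thesis
      using increment_le_of_ell_close[OF W x(1,2) _ x(3)] W unfolding small_increments_def by simp
  qed
  then have "\<exists>n\<ge>N. n \<in> {n. n \<ge> 1 \<and>
      \<not> (\<exists>x. length x = n \<and> set x \<subseteq> {-1, 1} \<and>
            mdist C01 (ell x) W \<le> 1 / 2 * sqrt (ln (real n) / real n))}" for N
    using large[of N] by blast
  then have "infinite {n. n \<ge> 1 \<and>
      \<not> (\<exists>x. length x = n \<and> set x \<subseteq> {-1, 1} \<and>
            mdist C01 (ell x) W \<le> 1 / 2 * sqrt (ln (real n) / real n))}"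
    unfolding infinite_nat_iff_unbounded_le by blast
  with random show ?thesis
    by blast
qed

end
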